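(* Let $\mathfrak S$ be a split system on a multiset $\mathcal M$ in which every split has the same size. Then $\mathfrak S$ is compatible if and only if every submultiset of $\mathfrak S$ of size at most $\Delta(\mathcal M)+2$ is compatible.
   Context: A multiset $\mathcal M$ has underlying set $X$; $\mathcal M(x)\ge 1$ is the multiplicity of $x\in X$, and $\Delta(\mathcal M)=\sum_{x\in X}(\mathcal M(x)-1)$. Unions, inclusions, differences and cardinalities are in the multiset sense. A split of $\mathcal M$ is an unordered pair $\{A,B\}$, written $A|B$, of nonempty submultisets with multiset union $\mathcal M$; $\overline A=\mathcal M-A$. The size of a split $A|\overline A$ is $\min\{|A|,|\overline A|\}$. A split system on $\mathcal M$ is a finite multiset of splits; the size of a submultiset counts multiplicity. An $\mathcal M$-tree is a finite tree $T$ with a labeling $\lambda$ of vertices by submultisets of $\mathcal M$ such that the multiset union of all labels is $\mathcal M$ and every vertex of degree $1$ or $2$ has nonempty label. Each edge $e$ induces the split $A|B$ with $A$, $B$ the multiset unions of labels in the two components of $T-e$; the tree represents the multiset of splits induced by all its edges. A split system is compatible if some $\mathcal M$-tree represents it. *)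

theory Defs
  imports "HOL-Library.Multiset" "HOL-Library.Uprod"
begin

definition Delta :: "'a multiset \<Rightarrow> nat" where
  "Delta M = (\<Sum>x\<in>set_mset M. count M x - 1)"

text \<open>
  A split \<open>A|B\<close> is the unordered pair \<open>Upair A B\<close>; the case \<open>A = B\<close> is allowed.
\<close>

definition is_split :: "'a multiset \<Rightarrow> 'a multiset uprod \<Rightarrow> bool" where
  "is_split M s \<longleftrightarrow> (\<exists>A B. s = Upair A B \<and> A \<noteq> {#} \<and> B \<noteq> {#} \<and> A + B = M)"

definition split_size :: "'a multiset uprod \<Rightarrow> nat" where
  "split_size s = Min (size ` set_uprod s)"

definition split_system :: "'a multiset \<Rightarrow> 'a multiset uprod multiset \<Rightarrow> bool" where
  "split_system M S \<longleftrightarrow> (\<forall>s\<in>#S. is_split M s)"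

definition simple_graph :: "'v set \<Rightarrow> 'v uprod set \<Rightarrow> bool" where
  "simple_graph V E \<longleftrightarrow> (\<forall>e\<in>E. proper_uprod e \<and> set_uprod e \<subseteq> V)"

definition adj :: "'v uprod set \<Rightarrow> ('v \<times> 'v) set" where
  "adj E = {(u, v). Upair u v \<in> E}"

definition component :: "'v uprod set \<Rightarrow> 'v \<Rightarrow> 'v set" where
  "component E u = {v. (u, v) \<in> (adj E)\<^sup>*}"

definition is_cycle :: "'v uprod set \<Rightarrow> 'v list \<Rightarrow> bool" where
  "is_cycle E p \<longleftrightarrow> 3 \<le> length p \<and> distinct p \<and>
     (\<forall>i<length p. Upair (p ! i) (p ! (Suc i mod length p)) \<in> E)"

definition finite_tree :: "'v set \<Rightarrow> 'v uprod set \<Rightarrow> bool" where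
  "finite_tree V E \<longleftrightarrow> finite V \<and> V \<noteq> {} \<and> simple_graph V E \<and>
     (\<forall>u\<in>V. \<forall>v\<in>V. (u, v) \<in> (adj E)\<^sup>*) \<and> (\<nexists>p. is_cycle E p)"

definition degree :: "'v uprod set \<Rightarrow> 'v \<Rightarrow> nat" where
  "degree E v = card {e \<in> E. v \<in> set_uprod e}"

definition M_tree ::
    "'a multiset \<Rightarrow> 'v set \<Rightarrow> 'v uprod set \<Rightarrow> ('v \<Rightarrow> 'a multiset) \<Rightarrow> bool" where
  "M_tree M V E lab \<longleftrightarrow> finite_tree V E \<and>
     (\<forall>v\<in>V. lab v \<subseteq># M) \<and> (\<Sum>v\<in>V. lab v) = M \<and>
     (\<forall>v\<in>V. degree E v \<in> {1, 2} \<longrightarrow> lab v \<noteq> {#})"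

text \<open>
  For \<open>e = Upair u v\<close> this is \<open>A|B\<close>, where \<open>A\<close> and \<open>B\<close> are the label sums over the
  components of \<open>u\<close> and of \<open>v\<close> in the tree with the edge \<open>e\<close> removed.
\<close>

definition edge_split ::
    "'v uprod set \<Rightarrow> ('v \<Rightarrow> 'a multiset) \<Rightarrow> 'v uprod \<Rightarrow> 'a multiset uprod" where
  "edge_split E lab e = map_uprod (\<lambda>u. \<Sum>w\<in>component (E - {e}) u. lab w) e"

definition tree_splits ::
    "'v uprod set \<Rightarrow> ('v \<Rightarrow> 'a multiset) \<Rightarrow> 'a multiset uprod multiset" where
  "tree_splits E lab = image_mset (edge_split E lab) (mset_set E)"

text \<open>
  Every finite tree is isomorphic to one whose vertices are natural numbers, so it is no
  restriction to let the trees range over those.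
\<close>

definition compatible :: "'a multiset \<Rightarrow> 'a multiset uprod multiset \<Rightarrow> bool" where
  "compatible M S \<longleftrightarrow>
     (\<exists>(V :: nat set) E lab. M_tree M V E lab \<and> tree_splits E lab = S)"

end

theory Submission
  imports Defs
begin

text \<open>
  If all splits induced by the edges of an \<open>M\<close>-tree have the same size, then the end of an
  edge on its smaller side is a leaf: a second edge at that end would cut off a strictly smaller
  part.  So the tree is a star, and a split system of constant size is compatible iff its smaller
  sides together fit into \<open>M\<close> (and, for two splits, do not exhaust \<open>M\<close>, because the centre of the
  star then has degree 2).  If they do not fit, some \<open>x\<close> is used too often, and then
  \<open>count M x + 1 \<le> Delta M + 2\<close> splits whose smaller side contains \<open>x\<close> already do not fit.
\<close>

section \<open>Components of a tree after removing an edge\<close>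

lemma Upair_commute: "Upair x y = Upair y x"
  by simp

lemma set_uprodE:
  assumes "u \<in> set_uprod e"
  obtains v where "e = Upair u v"
  using assms by (cases e) auto

lemma adj_iff [simp]: "(x, y) \<in> adj E \<longleftrightarrow> Upair x y \<in> E"
  by (simp add: adj_def)

lemma sym_adj: "sym (adj E)"
  by (rule symI) (metis Upair_commute adj_iff)

lemma component_refl [simp]: "u \<in> component E u"
  by (simp add: component_def)

lemma component_trans: "v \<in> component E u \<Longrightarrow> w \<in> component E v \<Longrightarrow> w \<in> component E u"
  by (auto simp: component_def)

lemma component_sym: "v \<in> component E u \<Longrightarrow> u \<in> component E v"
  unfolding component_def using sym_rtrancl[OF sym_adj[of E]] by (auto dest: symD)

lemma component_step: "v \<in> component E u \<Longrightarrow> Upair v w \<in> E \<Longrightarrow> w \<in> component E u"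
  unfolding component_def by (auto intro: rtrancl_into_rtrancl)

lemma component_induct [consumes 1, case_names base step]:
  assumes "x \<in> component E u"
    and "P u"
    and "\<And>y z. y \<in> component E u \<Longrightarrow> P y \<Longrightarrow> Upair y z \<in> E \<Longrightarrow> P z"
  shows "P x"
proof -
  have "(u, x) \<in> (adj E)\<^sup>*"
    using assms(1) by (simp add: component_def)
  then show ?thesis
    by (induction rule: rtrancl_induct) (auto simp: component_def intro: assms(2,3))
qed

lemma component_subset:
  assumes "simple_graph V E" "F \<subseteq> E" "u \<in> V"
  shows "component F u \<subseteq> V"
proof
  fix x assume "x \<in> component F u"
  then show "x \<in> V"
    by (induction rule: component_induct) (use assms in \<open>force simp: simple_graph_def\<close>)+
qed

text \<open>Cycles are vertex lists, while components come from a reachability relation; this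
  supplies the list from which a cycle can be built. Along a walk, a repeated vertex is handled by
  cutting the path right after its earlier occurrence, a new vertex by appending it.\<close>

lemma component_distinct_path:
  assumes "v \<in> component E u"
  obtains p where "p \<noteq> []" "distinct p" "hd p = u" "last p = v"
    "\<forall>i. Suc i < length p \<longrightarrow> Upair (p ! i) (p ! Suc i) \<in> E"
proof -
  have "\<exists>p. p \<noteq> [] \<and> distinct p \<and> hd p = u \<and> last p = v \<and>
    (\<forall>i. Suc i < length p \<longrightarrow> Upair (p ! i) (p ! Suc i) \<in> E)"
    using assms
  proof (induction rule: component_induct)
    case base
    show ?case by (intro exI[of _ "[u]"]) auto
  next
    case (step y z)
    then obtain p where p: "p \<noteq> []" "distinct p" "hd p = u" "last p = y"
      "\<forall>i. Suc i < length p \<longrightarrow> Upair (p ! i) (p ! Suc i) \<in> E"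
      by blast
    show ?case
    proof (cases "z \<in> set p")
      case True
      then obtain j where j: "j < length p" "p ! j = z"
        by (auto simp: in_set_conv_nth)
      let ?q = "take (Suc j) p"
      have "last ?q = z"
        using j by (simp add: take_Suc_conv_app_nth)
      then show ?thesis
        using p j by (intro exI[of _ ?q]) (auto simp: hd_conv_nth)
    next
      case False
      have "Upair ((p @ [z]) ! i) ((p @ [z]) ! Suc i) \<in> E" if "Suc i < length (p @ [z])" for i
      proof (cases "Suc i < length p")
        case True
        then show ?thesis using p by (simp add: nth_append)
      next
        case False
        with that have "i = length p - 1" "Suc i = length p" by auto
        then show ?thesis
          using p step.hyps by (auto simp: nth_append last_conv_nth)
      qed
      then show ?thesis
        using p False by (intro exI[of _ "p @ [z]"]) auto
    qed
  qed
  then show thesis using that by blast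
qed

text \<open>A path from \<open>u\<close> to \<open>v\<close> avoiding the edge would close up with
  it to a cycle.\<close>

lemma tree_edge_bridge:
  assumes T: "finite_tree V E" and e: "Upair u v \<in> E"
  shows "v \<notin> component (E - {Upair u v}) u"
proof
  assume "v \<in> component (E - {Upair u v}) u"
  then obtain p where p: "p \<noteq> []" "distinct p" "hd p = u" "last p = v"
    and step: "\<forall>i. Suc i < length p \<longrightarrow> Upair (p ! i) (p ! Suc i) \<in> E - {Upair u v}"
    by (rule component_distinct_path)
  have "u \<noteq> v"
    using T e by (auto simp: finite_tree_def simple_graph_def)
  have ends: "p ! 0 = u" "p ! (length p - 1) = v"
    using p by (auto simp: hd_conv_nth last_conv_nth)
  \<comment> \<open>One vertex would force \<open>u = v\<close>; with two vertices the path would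
    use the removed edge itself.\<close>
  have "length p \<noteq> 1" "length p \<noteq> 2"
    using ends \<open>u \<noteq> v\<close> step by auto
  with p have len: "3 \<le> length p"
    by (cases p) (auto simp: neq_Nil_conv Suc_le_eq intro: ccontr)
  have "Upair (p ! i) (p ! (Suc i mod length p)) \<in> E" if "i < length p" for i
  proof (cases "Suc i < length p")
    case True
    then show ?thesis using step by auto
  next
    case False
    \<comment> \<open>The closing step, from the last vertex back to index 0, is the removed
      edge.\<close>
    with that have "Suc i = length p" by simp
    then show ?thesis
      using ends e by (metis Upair_commute diff_Suc_1 mod_self)
  qed
  with len p have "is_cycle E p"
    by (simp add: is_cycle_def)
  then show False
    using T by (auto simp: finite_tree_def)
qed

lemma tree_branch_avoids_root:
  assumes "finite_tree V E" "Upair u z \<in> E"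
  shows "u \<notin> component (E - {Upair u z}) z"
  using tree_edge_bridge[OF assms] component_sym by fast

text \<open>The branch behind \<open>z\<close> is entered from \<open>u\<close> by an edge other
  than \<open>Upair u v\<close>. Walks inside it never meet \<open>u\<close>, so they never use
  \<open>Upair u v\<close> either.\<close>

lemma tree_branch_subset:
  assumes T: "finite_tree V E" and h: "Upair u z \<in> E" and ne: "Upair u z \<noteq> Upair u v"
  shows "component (E - {Upair u z}) z \<subseteq> component (E - {Upair u v}) u"
proof
  note root = tree_branch_avoids_root[OF T h]
  fix x assume "x \<in> component (E - {Upair u z}) z"
  then show "x \<in> component (E - {Upair u v}) u"
  proof (induction rule: component_induct)
    case base
    show ?case
      using component_step[of u "E - {Upair u v}" u z] h ne by simp
  next
    case (step y x)
    have "x \<in> component (E - {Upair u z}) z"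
      using step component_step by metis
    with root step.hyps have "y \<noteq> u" "x \<noteq> u" by auto
    then have "Upair y x \<in> E - {Upair u v}"
      using step.hyps by auto
    with step.IH show ?case by (rule component_step)
  qed
qed

text \<open>After removal of the edge to \<open>y\<close>, the branch behind \<open>z\<close> stays
  on the side of \<open>u\<close>, and the bridge property separates that side from the branch
  behind \<open>y\<close>.\<close>

lemma tree_branches_disjoint:
  assumes T: "finite_tree V E" and h: "Upair u y \<in> E" "Upair u z \<in> E"
    and ne: "Upair u y \<noteq> Upair u z"
  shows "component (E - {Upair u y}) y \<inter> component (E - {Upair u z}) z = {}"
proof -
  have "component (E - {Upair u z}) z \<subseteq> component (E - {Upair u y}) u"
    using tree_branch_subset[OF T h(2)] ne by metis
  moreover have "x \<notin> component (E - {Upair u y}) u" if "x \<in> component (E - {Upair u y}) y" for x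
    using tree_branch_avoids_root[OF T h(1)] component_trans[OF that] component_sym by fast
  ultimately show ?thesis by blast
qed

lemma finite_tree_edges:
  assumes "finite_tree V E"
  shows "finite E"
proof (rule finite_subset)
  show "E \<subseteq> (\<lambda>(x, y). Upair x y) ` (V \<times> V)"
  proof
    fix e assume "e \<in> E"
    then show "e \<in> (\<lambda>(x, y). Upair x y) ` (V \<times> V)"
      using assms by (cases e) (force simp: finite_tree_def simple_graph_def)
  qed
  show "finite ((\<lambda>(x, y). Upair x y) ` (V \<times> V))"
    using assms by (simp add: finite_tree_def)
qed

section \<open>Trees all of whose splits have the same size\<close>

lemma sum_mset_mono_set:
  fixes f :: "'v \<Rightarrow> 'a multiset"
  assumes "finite B" "A \<subseteq> B"
  shows "sum f A \<subseteq># sum f B"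
proof -
  have "sum f B = sum f (B - A) + sum f A"
    by (rule sum.subset_diff[OF assms(2,1)])
  then show ?thesis by simp
qed

text \<open>A side of least possible size \<open>k\<close> has no room for branching: a second edge
  at \<open>u\<close> would cut off a branch that already takes all \<open>k\<close> elements, so
  \<open>u\<close> would be unlabelled and need a third edge, whose branch would find nothing left.
  The bound \<open>large\<close> covers both sides of each edge, as \<open>x\<close> and
  \<open>y\<close> are interchangeable.\<close>

lemma small_side_leaf:
  assumes T: "M_tree M V E lab"
    and large: "\<And>x y. Upair x y \<in> E \<Longrightarrow> k \<le> size (sum lab (component (E - {Upair x y}) x))"
    and e: "Upair u v \<in> E" and k: "size (sum lab (component (E - {Upair u v}) u)) = k" "k > 0"
  shows "{f \<in> E. u \<in> set_uprod f} = {Upair u v}"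
    and "component (E - {Upair u v}) u = {u}"
proof -
  have tree: "finite_tree V E"
    using T by (simp add: M_tree_def)
  then have graph: "simple_graph V E" and fin: "finite V"
    by (auto simp: finite_tree_def)
  have u: "u \<in> V"
    using graph e by (auto simp: simple_graph_def)
  let ?C = "component (E - {Upair u v}) u"
  have C: "finite ?C"
    by (rule finite_subset[OF component_subset[OF graph _ u] fin]) auto
  have unique: "f = Upair u v" if f: "f \<in> E" "u \<in> set_uprod f" for f
  proof (rule ccontr)
    assume ne: "f \<noteq> Upair u v"
    obtain z where z: "f = Upair u z"
      using f(2) by (rule set_uprodE)
    let ?D = "component (E - {Upair u z}) z"
    have D: "?D \<subseteq> ?C" "u \<notin> ?D"
      using tree_branch_subset[OF tree, of u z v] tree_branch_avoids_root[OF tree, of u z]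
        f ne z by auto
    have "k \<le> size (sum lab ?D)"
      using large[of z u] f z by (simp add: Upair_commute)
    moreover have "size (sum lab (?C - ?D)) + size (sum lab ?D) = k"
      using sum.subset_diff[OF D(1) C, of lab] k(1) by (metis size_union)
    ultimately have "size (sum lab (?C - ?D)) = 0" by linarith
    then have empty: "sum lab (?C - ?D) = {#}" by (rule size_eq_0_iff_empty[THEN iffD1])
    \<comment> \<open>\<open>u\<close> itself lies in \<open>?C - ?D\<close>.\<close>
    then have "lab u = {#}"
      using sum_mset_mono_set[of "?C - ?D" "{u}" lab] C D(2) by simp
    then have "degree E u \<notin> {1, 2}"
      using T u by (auto simp: M_tree_def)
    moreover have "2 \<le> degree E u"
    proof -
      have "card {Upair u v, f} \<le> degree E u"
        unfolding degree_def using f e finite_tree_edges[OF tree] by (intro card_mono) auto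
      then show ?thesis using ne by simp
    qed
    \<comment> \<open>Two edges are known and degree 2 is excluded, so a third edge \<open>g\<close>
      exists.\<close>
    ultimately have "card {Upair u v, f} < card {g \<in> E. u \<in> set_uprod g}"
      using ne by (auto simp: degree_def)
    then have "\<not> {g \<in> E. u \<in> set_uprod g} \<subseteq> {Upair u v, f}"
      using card_mono[of "{Upair u v, f}"] by (metis finite.emptyI finite.insertI not_le)
    then obtain g where g: "g \<in> E" "u \<in> set_uprod g" "g \<noteq> Upair u v" "g \<noteq> f"
      by blast
    obtain y where y: "g = Upair u y"
      using g(2) by (rule set_uprodE)
    let ?F = "component (E - {Upair u y}) y"
    \<comment> \<open>The third branch falls into the part just shown to carry no labels.\<close>
    have "?F \<subseteq> ?C - ?D"
      using tree_branch_subset[OF tree, of u y v] tree_branches_disjoint[OF tree, of u y z]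
        g y f z by auto
    then have "sum lab ?F = {#}"
      using sum_mset_mono_set[of "?C - ?D" ?F lab] C empty by simp
    moreover have "k \<le> size (sum lab ?F)"
      using large[of y u] g y by (simp add: Upair_commute)
    ultimately show False using k(2) by (metis size_empty not_le)
  qed
  show "{f \<in> E. u \<in> set_uprod f} = {Upair u v}"
  proof (intro equalityI subsetI)
    fix f assume "f \<in> {f \<in> E. u \<in> set_uprod f}"
    then have "f = Upair u v" by (intro unique) blast+
    then show "f \<in> {Upair u v}" by blast
  qed (use e in simp)
  \<comment> \<open>With its only edge removed, \<open>u\<close> is isolated.\<close>
  have "x = u" if "x \<in> ?C" for x
    using that
  proof (induction rule: component_induct)
    case (step y z)
    then have "Upair u z \<in> E" "Upair u z \<noteq> Upair u v" by auto
    then show ?case using unique[of "Upair u z"] by simp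
  qed simp
  then show "?C = {u}" by auto
qed

section \<open>Smaller sides of splits\<close>

text \<open>When both sides have equal size the choice is arbitrary; later arguments rely only on
  membership and size.\<close>

definition small_side :: "'a multiset uprod \<Rightarrow> 'a multiset" where
  "small_side s = (SOME A. A \<in> set_uprod s \<and> size A = split_size s)"

lemma small_side:
  shows "small_side s \<in> set_uprod s" and "size (small_side s) = split_size s"
proof -
  have "set_uprod s \<noteq> {}" by (cases s) auto
  then have "split_size s \<in> size ` set_uprod s"
    unfolding split_size_def by (intro Min_in) auto
  then have "\<exists>A. A \<in> set_uprod s \<and> size A = split_size s" by auto
  from someI_ex[OF this]
  show "small_side s \<in> set_uprod s" and "size (small_side s) = split_size s"
    by (simp_all add: small_side_def)
qed

lemma split_size_le: "A \<in> set_uprod s \<Longrightarrow> split_size s \<le> size A"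
  unfolding split_size_def by (intro Min_le) auto

text \<open>The inclusion in \<open>M\<close> is strict because the other side is nonempty; this
  later gives the centre of a one-leaf star a nonempty label.\<close>

lemma split_small_side:
  assumes "is_split M s"
  shows "small_side s \<noteq> {#}" "small_side s \<subset># M" "s = Upair (small_side s) (M - small_side s)"
proof -
  obtain B where B: "s = Upair (small_side s) B"
    using small_side(1) by (rule set_uprodE)
  obtain C D where CD: "s = Upair C D" "C \<noteq> {#}" "D \<noteq> {#}" "C + D = M"
    using assms by (auto simp: is_split_def)
  have "Upair (small_side s) B = Upair C D"
    using B CD(1) by (rule trans[OF sym])
  then have *: "small_side s \<noteq> {#}" "B \<noteq> {#}" "M = small_side s + B"
    using CD by (auto simp: add.commute)
  show "small_side s \<noteq> {#}" by (rule *)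
  show "small_side s \<subset># M" using * by (simp add: subset_mset.less_le)
  have "B = M - small_side s" using *(3) by simp
  then show "s = Upair (small_side s) (M - small_side s)" using B by (rule subst)
qed

section \<open>Necessary conditions read off from a representing tree\<close>

text \<open>Each edge \<open>e\<close> has a leaf \<open>L e\<close> labelled by the smaller side of
  its split, and different edges have different leaves, so the smaller sides are labels of distinct
  vertices. If two of them exhausted \<open>M\<close>, the centre would have an empty label and
  degree 1 or 2.\<close>

lemma compatible_small_sides:
  assumes split: "split_system M S" and k: "\<forall>s\<in>#S. split_size s = k"
    and comp: "compatible M S"
  shows "(\<Sum>s\<in>#S. small_side s) \<subseteq># M"
    and "size S = 2 \<Longrightarrow> (\<Sum>s\<in>#S. small_side s) \<noteq> M"
proof -
  obtain V :: "nat set" and E lab where T: "M_tree M V E lab" and S: "tree_splits E lab = S"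
    using comp by (auto simp: compatible_def)
  have tree: "finite_tree V E"
    using T by (simp add: M_tree_def)
  then have fin: "finite V" "finite E" and graph: "simple_graph V E"
    using finite_tree_edges by (auto simp: finite_tree_def)
  have setS: "set_mset S = edge_split E lab ` E"
    using fin S by (auto simp: tree_splits_def)
  have side: "sum lab (component (E - {Upair x y}) x) \<in> set_uprod (edge_split E lab (Upair x y))"
    for x y by (simp add: edge_split_def)
  have large: "k \<le> size (sum lab (component (E - {Upair x y}) x))" if "Upair x y \<in> E" for x y
    using split_size_le[OF side[of x y]] k that setS by auto
  have "\<exists>u. u \<in> set_uprod e \<and> {f \<in> E. u \<in> set_uprod f} = {e} \<and>
      lab u = small_side (edge_split E lab e)" if e: "e \<in> E" for e
  proof -
    let ?s = "edge_split E lab e"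
    have s: "?s \<in># S" using e setS by simp
    then have "is_split M ?s"
      using split by (simp add: split_system_def)
    then have "small_side ?s \<noteq> {#}"
      by (rule split_small_side)
    then have pos: "k > 0"
      using small_side(2)[of ?s] k s by (metis nonempty_has_size)
    have "small_side ?s \<in> (\<lambda>u. sum lab (component (E - {e}) u)) ` set_uprod e"
      using small_side(1)[of ?s] by (simp add: edge_split_def uprod.set_map)
    then obtain u where u: "u \<in> set_uprod e" "small_side ?s = sum lab (component (E - {e}) u)"
      by auto
    obtain v where v: "e = Upair u v"
      using u(1) by (rule set_uprodE)
    have "size (sum lab (component (E - {Upair u v}) u)) = k"
      using u v k s small_side(2)[of ?s] by simp
    note leaf = small_side_leaf[OF T large _ this pos]
    show ?thesis
      using leaf e u v by (intro exI[of _ u]) auto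
  qed
  then obtain L where L: "\<And>e. e \<in> E \<Longrightarrow> L e \<in> set_uprod e"
    "\<And>e. e \<in> E \<Longrightarrow> {f \<in> E. L e \<in> set_uprod f} = {e}"
    "\<And>e. e \<in> E \<Longrightarrow> lab (L e) = small_side (edge_split E lab e)"
    by metis
  \<comment> \<open>The leaf determines the edge, being incident with no other.\<close>
  have inj: "inj_on L E"
    using L(2) by (intro inj_onI) (metis singleton_inject)
  have LV: "L ` E \<subseteq> V"
    using L(1) graph by (auto simp: simple_graph_def)
  have "(\<Sum>s\<in>#S. small_side s) = (\<Sum>e\<in>E. small_side (edge_split E lab e))"
    by (simp add: S[symmetric] tree_splits_def sum_unfold_sum_mset multiset.map_comp o_def)
  also have "\<dots> = sum lab (L ` E)"
    using L(3) inj by (simp add: sum.reindex)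
  finally have sum: "(\<Sum>s\<in>#S. small_side s) = sum lab (L ` E)" .
  have M: "sum lab V = M"
    using T by (simp add: M_tree_def)
  show "(\<Sum>s\<in>#S. small_side s) \<subseteq># M"
    using sum_mset_mono_set[OF fin(1) LV, of lab] sum M by simp
  show "(\<Sum>s\<in>#S. small_side s) \<noteq> M" if "size S = 2"
  proof
    assume eq: "(\<Sum>s\<in>#S. small_side s) = M"
    have card: "card E = 2"
      using that unfolding S[symmetric] tree_splits_def by simp
    then obtain e where e: "e \<in> E" by fastforce
    \<comment> \<open>This other end \<open>v\<close> is the centre, whose label leads to the
      contradiction.\<close>
    obtain v where v: "e = Upair (L e) v"
      using L(1)[OF e] by (rule set_uprodE)
    have "proper_uprod (Upair (L e) v)" "set_uprod (Upair (L e) v) \<subseteq> V"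
      using graph e unfolding simple_graph_def v[symmetric] by auto
    moreover have "v \<in> set_uprod e"
      by (subst v) simp
    ultimately have vV: "v \<in> V" "v \<noteq> L e" "v \<in> set_uprod e"
      by auto
    \<comment> \<open>The only edge at \<open>L f\<close> is \<open>f\<close>, so
      \<open>v = L f\<close> would give \<open>e = f\<close> and hence
      \<open>v = L e\<close>.\<close>
    have "v \<noteq> L f" if "f \<in> E" for f
      using L(2)[OF that] vV e by (metis (mono_tags, lifting) mem_Collect_eq singletonD)
    then have "v \<in> V - L ` E" using vV by auto
    moreover have "sum lab (V - L ` E) = {#}"
      using sum.subset_diff[OF LV fin(1), of lab] M sum eq by simp
    ultimately have "lab v = {#}"
      using sum_mset_mono_set[of "V - L ` E" "{v}" lab] fin by simp
    then have "degree E v \<notin> {1, 2}"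
      using T vV by (auto simp: M_tree_def)
    moreover have "degree E v \<le> 2"
      unfolding degree_def card[symmetric] using fin by (intro card_mono) auto
    moreover have "degree E v \<noteq> 0"
      unfolding degree_def using fin e vV by auto
    ultimately show False by (cases "degree E v") auto
  qed
qed

section \<open>Stars\<close>

text \<open>The centre 0 carries what the leaves leave over, and leaf \<open>Suc i\<close> carries
  \<open>As ! i\<close>. The centre has degree \<open>length As\<close>, so its label must be
  nonempty exactly for one or two leaves; without leaves the tree is a single vertex of degree 0. A
  list is used to index the leaves, repetitions included.\<close>

lemma compatible_star:
  fixes M :: "'a multiset" and As :: "'a multiset list"
  assumes ne: "{#} \<notin> set As" and sub: "sum_list As \<subseteq># M"
    and center: "length As \<in> {1, 2} \<Longrightarrow> sum_list As \<noteq> M"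
  shows "compatible M (mset (map (\<lambda>A. Upair A (M - A)) As))"
proof -
  define m where "m = length As"
  define V where "V = insert 0 (Suc ` {..<m})"
  define spoke where "spoke i = Upair 0 (Suc i)" for i
  define E where "E = spoke ` {..<m}"
  define lab where "lab v = (case v of 0 \<Rightarrow> M - sum_list As | Suc i \<Rightarrow> As ! i)" for v
  have inj: "inj spoke" by (auto simp: spoke_def inj_def)
  have E_iff: "Upair x y \<in> E \<longleftrightarrow> (\<exists>i<m. x = 0 \<and> y = Suc i \<or> x = Suc i \<and> y = 0)" for x y
    by (auto simp: E_def spoke_def)
  have graph: "simple_graph V E"
    by (auto simp: simple_graph_def E_def V_def spoke_def)
  have reach: "v \<in> component E 0" if "v \<in> V" for v
    using that component_step[of 0 E 0] by (auto simp: V_def E_iff)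
  have conn: "v \<in> component E u" if "u \<in> V" "v \<in> V" for u v
    using reach that component_sym component_trans by metis
  have acyc: "\<not> is_cycle E p" for p
  proof
    assume p: "is_cycle E p"
    then have len: "3 \<le> length p" and dist: "distinct p"
      and edge: "\<And>i. i < length p \<Longrightarrow> Upair (p ! i) (p ! (Suc i mod length p)) \<in> E"
      by (auto simp: is_cycle_def)
    have inj': "p ! i = p ! j \<longleftrightarrow> i = j" if "i < length p" "j < length p" for i j
      using dist that by (rule nth_eq_iff_index_eq)
    \<comment> \<open>The position following 2 on the cycle: 0 for length 3, otherwise 3. Every edge
      contains the centre, so the first three edges put 0 at two different positions.\<close>
    let ?j = "3 mod length p"
    have j: "?j < length p" "?j \<noteq> 1"
      using len by (auto simp: le_less)
    have "p ! 0 = 0 \<or> p ! 1 = 0" "p ! 1 = 0 \<or> p ! 2 = 0" "p ! 2 = 0 \<or> p ! ?j = 0"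
      using edge[of 0] edge[of 1] edge[of 2] len
      by (auto simp: E_iff numeral_2_eq_2 numeral_3_eq_3 simp del: length_greater_0_conv)
    then show False
      using inj'[of 0 2] inj'[of 1 2] inj'[of 1 ?j] len j by force
  qed
  have tree: "finite_tree V E"
    using graph conn acyc by (auto simp: finite_tree_def component_def V_def)
  have sum_leaves: "(\<Sum>v\<in>Suc ` {..<m}. lab v) = sum_list As"
    by (simp add: sum.reindex lab_def m_def sum_list_sum_nth atLeast0LessThan)
  have sumV: "sum lab V = M"
    using sub sum_leaves by (simp add: V_def lab_def)
  have "finite V" by (simp add: V_def)
  have labsub: "lab v \<subseteq># M" if "v \<in> V" for v
    using sum_mset_mono_set[OF \<open>finite V\<close>, of "{v}" lab] that sumV by simp
  have "degree E 0 = m"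
  proof -
    have "{e \<in> E. 0 \<in> set_uprod e} = E" by (auto simp: E_def spoke_def)
    then show ?thesis
      unfolding degree_def E_def using inj by (simp add: card_image inj_on_subset)
  qed
  then have deg: "lab v \<noteq> {#}" if "v \<in> V" "degree E v \<in> {1, 2}" for v
  proof (cases v)
    case 0
    then show ?thesis
      using that \<open>degree E 0 = m\<close> center sub
      by (auto simp: lab_def m_def dest: subset_mset.antisym simp: Diff_eq_empty_iff_mset)
  next
    case (Suc i)
    then have "As ! i \<in> set As" using that by (auto simp: V_def m_def)
    then show ?thesis using ne Suc by (auto simp: lab_def)
  qed
  have MT: "M_tree M V E lab"
    using tree labsub sumV deg by (simp add: M_tree_def)
  have split: "edge_split E lab (spoke i) = Upair (As ! i) (M - As ! i)" if i: "i < m" for i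
  proof -
    have "x = Suc i" if "x \<in> component (E - {spoke i}) (Suc i)" for x
      using that by (induction rule: component_induct) (auto simp: E_iff spoke_def)
    then have leaf: "component (E - {spoke i}) (Suc i) = {Suc i}" by auto
    \<comment> \<open>Removing a spoke detaches its leaf alone; the other leaves keep their own
      spokes.\<close>
    have "component (E - {spoke i}) 0 = V - {Suc i}"
    proof (intro equalityI subsetI)
      fix x assume x: "x \<in> component (E - {spoke i}) 0"
      then have "x \<in> V"
        using component_subset[OF graph, of "E - {spoke i}" 0] by (auto simp: V_def)
      moreover have "x \<noteq> Suc i"
        using leaf x component_sym by fastforce
      ultimately show "x \<in> V - {Suc i}" by simp
    next
      fix x assume "x \<in> V - {Suc i}"
      then show "x \<in> component (E - {spoke i}) 0"
        using component_step[of 0 "E - {spoke i}" 0 x]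
        by (cases x) (auto simp: V_def E_iff spoke_def)
    qed
    moreover have "sum lab (V - {Suc i}) = M - lab (Suc i)"
    proof -
      have "Suc i \<in> V" using i by (auto simp: V_def)
      then have "sum lab V = lab (Suc i) + sum lab (V - {Suc i})"
        using \<open>finite V\<close> by (rule sum.remove[rotated])
      then show ?thesis using sumV by simp
    qed
    ultimately show ?thesis
      using leaf by (simp add: edge_split_def spoke_def lab_def Upair_commute)
  qed
  have "mset_set E = image_mset spoke (mset_set {..<m})"
    unfolding E_def using inj by (simp add: image_mset_mset_set inj_on_subset)
  then have "tree_splits E lab = image_mset (\<lambda>i. edge_split E lab (spoke i)) (mset_set {..<m})"
    by (simp add: tree_splits_def multiset.map_comp o_def)
  also have "\<dots> = image_mset (\<lambda>i. Upair (As ! i) (M - As ! i)) (mset_set {..<m})"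
    using split by (intro image_mset_cong) auto
  also have "\<dots> = mset (map (\<lambda>i. Upair (As ! i) (M - As ! i)) [0..<m])"
    by (simp add: atLeast0LessThan[symmetric])
  also have "map (\<lambda>i. Upair (As ! i) (M - As ! i)) [0..<m] = map (\<lambda>A. Upair A (M - A)) As"
    by (rule nth_equalityI) (simp_all add: m_def)
  finally show ?thesis
    using MT unfolding compatible_def by blast
qed

text \<open>Necessity was read off from the tree; for sufficiency the star with the smaller sides as
  leaves represents \<open>S\<close>. Only size 2 needs an extra condition, since a single smaller
  side is always a proper submultiset of \<open>M\<close>.\<close>

lemma compatible_iff_small_sides:
  assumes split: "split_system M S" and k: "\<forall>s\<in>#S. split_size s = k"
  shows "compatible M S \<longleftrightarrow>
    (\<Sum>s\<in>#S. small_side s) \<subseteq># M \<and> (size S = 2 \<longrightarrow> (\<Sum>s\<in>#S. small_side s) \<noteq> M)"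
    (is "_ \<longleftrightarrow> ?sub \<and> ?ne")
proof
  assume "compatible M S"
  then show "?sub \<and> ?ne"
    using compatible_small_sides[OF assms] by blast
next
  assume fit: "?sub \<and> ?ne"
  obtain ss where ss: "mset ss = S"
    using ex_mset by blast
  have splits: "is_split M s" if "s \<in> set ss" for s
    using split that ss by (auto simp: split_system_def)
  let ?As = "map small_side ss"
  have sum: "sum_list ?As = (\<Sum>s\<in>#S. small_side s)"
    by (simp add: ss[symmetric] sum_mset_sum_list[symmetric])
  have "compatible M (mset (map (\<lambda>A. Upair A (M - A)) ?As))"
  proof (rule compatible_star)
    show "{#} \<notin> set ?As"
      using split_small_side(1)[OF splits] by fastforce
    show "sum_list ?As \<subseteq># M"
      using fit sum by simp
    assume "length ?As \<in> {1, 2}"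
    then consider "length ss = 1" | "size S = 2"
      using ss by auto
    then show "sum_list ?As \<noteq> M"
    proof cases
      case 1
      then obtain s where "ss = [s]" by (auto simp: length_Suc_conv)
      then show ?thesis using split_small_side(2)[OF splits] by auto
    next
      case 2
      then show ?thesis using fit sum by simp
    qed
  qed
  moreover have "map (\<lambda>A. Upair A (M - A)) ?As = ss"
    using split_small_side(3)[OF splits] by (simp add: map_idI)
  ultimately show "compatible M S"
    using ss by metis
qed

section \<open>Small incompatible subsystems\<close>

text \<open>The excess of \<open>x\<close> is one summand of \<open>Delta M\<close>. This is the
  source of the bound: one more than the multiplicity of \<open>x\<close> is at most
  \<open>Delta M + 2\<close>.\<close>

lemma count_le_Delta: "count M x \<le> Delta M + 1"
proof (cases "x \<in># M")
  case True
  then have "count M x - 1 \<le> Delta M"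
    unfolding Delta_def by (intro member_le_sum) auto
  then show ?thesis by simp
next
  case False
  then show ?thesis by (simp add: not_in_iff)
qed

lemma ex_submultiset_size:
  assumes "n \<le> size S"
  obtains R where "R \<subseteq># S" "size R = n"
proof -
  obtain ss where ss: "mset ss = S"
    using ex_mset by blast
  have "mset (take n ss) \<subseteq># S"
    using ss by (metis append_take_drop_id mset_append mset_subset_eq_add_left)
  moreover have "size (mset (take n ss)) = n"
    using assms ss by auto
  ultimately show thesis by (rule that)
qed

lemma size_le_count_sum_mset:
  assumes "\<forall>s\<in>#R. x \<in># f s"
  shows "size R \<le> count (\<Sum>s\<in>#R. f s) x"
  using assms
proof (induction R)
  case (add s R)
  then have "1 \<le> count (f s) x" "size R \<le> count (\<Sum>s\<in>#R. f s) x"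
    by (auto simp: Suc_le_eq)
  moreover have "size (add_mset s R) = 1 + size R"
    and "count (\<Sum>s\<in>#add_mset s R. f s) x = count (f s) x + count (\<Sum>s\<in>#R. f s) x"
    by simp_all
  ultimately show ?case by linarith
qed simp

text \<open>Some \<open>x\<close> is overused, and only the members of \<open>?F\<close> contribute
  to its count. If there are few of them, \<open>?F\<close> itself will do; otherwise any
  \<open>count M x + 1\<close> of them suffice, each contributing at least one
  \<open>x\<close>.\<close>

lemma sum_mset_not_subset_small:
  fixes f :: "'b \<Rightarrow> 'a multiset"
  assumes "\<not> (\<Sum>s\<in>#S. f s) \<subseteq># M"
  obtains R where "R \<subseteq># S" "size R \<le> Delta M + 2" "\<not> (\<Sum>s\<in>#R. f s) \<subseteq># M"
proof -
  obtain x where x: "count M x < count (\<Sum>s\<in>#S. f s) x"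
    using assms by (auto simp: subseteq_mset_def not_le)
  let ?F = "filter_mset (\<lambda>s. x \<in># f s) S"
  have count_eq: "count (\<Sum>s\<in>#S. f s) x = count (\<Sum>s\<in>#?F. f s) x"
    by (induction S) (auto simp: not_in_iff)
  show thesis
  proof (cases "size ?F \<le> count M x")
    case True
    show thesis
    proof (rule that[of ?F])
      show "size ?F \<le> Delta M + 2"
        using True count_le_Delta[of M x] by simp
      show "\<not> (\<Sum>s\<in>#?F. f s) \<subseteq># M"
        using x count_eq mset_subset_eq_count[of _ M x] by (metis not_le)
    qed simp
  next
    case False
    then obtain R where R: "R \<subseteq># ?F" "size R = count M x + 1"
      using ex_submultiset_size[of "count M x + 1" ?F] by auto
    have "\<forall>s\<in>#R. x \<in># f s"
      using R(1) by (auto dest: mset_subset_eqD)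
    then have "count M x < count (\<Sum>s\<in>#R. f s) x"
      using size_le_count_sum_mset[of R x f] R(2) by simp
    then have "\<not> (\<Sum>s\<in>#R. f s) \<subseteq># M"
      using mset_subset_eq_count[of _ M x] by (metis not_le)
    moreover have "R \<subseteq># S"
      using R(1) multiset_filter_subset subset_mset.order_trans by blast
    ultimately show thesis
      using that R(2) count_le_Delta[of M x] by simp
  qed
qed

section \<open>Reduction of compatibility to small subsystems\<close>

theorem theorem5:
  fixes M :: "'a multiset" and S :: "'a multiset uprod multiset"
  assumes "split_system M S"
    and "\<forall>s\<in>#S. \<forall>t\<in>#S. split_size s = split_size t"
  shows "compatible M S \<longleftrightarrow>
    (\<forall>R. R \<subseteq># S \<and> size R \<le> Delta M + 2 \<longrightarrow> compatible M R)"
proof -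
  obtain k where k: "\<forall>s\<in>#S. split_size s = k"
    using assms(2) by blast
  let ?sum = "\<lambda>R. \<Sum>s\<in>#R. small_side s"
  have compatible_iff: "compatible M R \<longleftrightarrow> ?sum R \<subseteq># M \<and> (size R = 2 \<longrightarrow> ?sum R \<noteq> M)"
    if "R \<subseteq># S" for R
  proof (rule compatible_iff_small_sides)
    show "split_system M R"
      using assms(1) that by (auto simp: split_system_def dest: mset_subset_eqD)
    show "\<forall>s\<in>#R. split_size s = k"
      using k that by (auto dest: mset_subset_eqD)
  qed
  show ?thesis
  proof (intro iffI allI impI)
    fix R assume comp: "compatible M S" and R: "R \<subseteq># S \<and> size R \<le> Delta M + 2"
    then have S: "?sum S \<subseteq># M" "size S = 2 \<Longrightarrow> ?sum S \<noteq> M"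
      using compatible_iff[of S] by auto
    obtain Q where Q: "S = R + Q"
      using R by (auto simp: subset_mset.le_iff_add)
    have "?sum R \<subseteq># M"
      using S(1) Q by (metis image_mset_union sum_mset.union mset_subset_eq_add_left
          subset_mset.order_trans)
    moreover have "?sum R \<noteq> M" if "size R = 2"
    proof
      assume eq: "?sum R = M"
      then have empty: "?sum Q = {#}"
        using S(1) Q by simp
      \<comment> \<open>Smaller sides are nonempty, so two splits exhausting \<open>M\<close> leave
        no room for further ones; then \<open>R\<close> is all of \<open>S\<close>, where this case
        is excluded.\<close>
      have "Q = {#}"
      proof (rule ccontr)
        assume "Q \<noteq> {#}"
        then obtain s where s: "s \<in># Q" by blast
        then have "small_side s = {#}"
          using empty by (auto dest!: multi_member_split)
        moreover have "is_split M s"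
          using assms(1) Q s by (simp add: split_system_def)
        ultimately show False
          using split_small_side(1) by blast
      qed
      then show False
        using Q S(2) that eq by simp
    qed
    ultimately show "compatible M R"
      using compatible_iff R by blast
  next
    assume small: "\<forall>R. R \<subseteq># S \<and> size R \<le> Delta M + 2 \<longrightarrow> compatible M R"
    have "?sum S \<subseteq># M"
    proof (rule ccontr)
      assume "\<not> ?sum S \<subseteq># M"
      then obtain R where "R \<subseteq># S" "size R \<le> Delta M + 2" "\<not> ?sum R \<subseteq># M"
        by (rule sum_mset_not_subset_small)
      then show False
        using small compatible_iff by blast
    qed
    \<comment> \<open>A system of size 2 is itself within the bound \<open>Delta M + 2\<close>, so
      the hypothesis applies to \<open>S\<close> directly.\<close>
    moreover have "?sum S \<noteq> M" if "size S = 2"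
      using small compatible_iff[of S] that by simp
    ultimately show "compatible M S"
      using compatible_iff[of S] by simp
  qed
qed

end
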